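(* For each integer $m\ge 2$ there exist non-zero real scalars $\lambda_1,\ldots,\lambda_m$ and pairwise independent linear functionals $\varphi_1,\ldots,\varphi_m$ on $\mathbb{R}^2$ (that is, $\varphi_i\neq\lambda\varphi_j$ for all $i\neq j$ and all $\lambda\in\mathbb{R}$), such that for every $j$ with $1\le j\le m$ neither $\varphi_j$ nor $-\varphi_j$ is a lattice homomorphism, and such that the $m$-homogeneous polynomial $\sum_{j=1}^m\lambda_j\varphi_j^m$ on $\mathbb{R}^2$ is orthogonally additive.
   Context: $\mathbb{R}^2$ is regarded as a Banach lattice with the standard (coordinatewise) order. Here $\varphi_j^m$ denotes the map $x\mapsto\varphi_j(x)^m$. An $m$-homogeneous polynomial $P$ on a Banach lattice $E$ (a map $P(x)=A(x,\dots,x)$ with $A\colon E^m\to\mathbb{R}$ bounded, symmetric and $m$-linear) is orthogonally additive if $P(x+y)=P(x)+P(y)$ whenever $|x|\wedge|y|=0$. A bounded linear functional $\varphi\colon E\to\mathbb{R}$ is a lattice homomorphism if $\varphi(x\vee y)=\max(\varphi(x),\varphi(y))$ and $\varphi(x\wedge y)=\min(\varphi(x),\varphi(y))$ for all $x,y\in E$. *)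

theory Defs
  imports "HOL-Analysis.Analysis"
begin

class banach_lattice = banach + ordered_real_vector + lattice + abs +
  assumes abs_eq_sup_minus: "\<bar>x\<bar> = sup x (- x)"
    and norm_mono_abs: "\<bar>x\<bar> \<le> \<bar>y\<bar> \<Longrightarrow> norm x \<le> norm y"

(* In particular real ^ 2, with its componentwise order, is a Banach lattice. *)
instance ordered_euclidean_space \<subseteq> banach_lattice
proof
  fix x y :: 'a
  show "\<bar>x\<bar> = sup x (- x)"
  proof (rule euclidean_eqI)
    fix i :: 'a assume i: "i \<in> Basis"
    have "\<bar>x \<bullet> i\<bar> = sup (x \<bullet> i) (- (x \<bullet> i))"
      unfolding sup_real_def by linarith
    then show "\<bar>x\<bar> \<bullet> i = sup x (- x) \<bullet> i"
      unfolding abs_inner[OF i] inner_Basis_sup_left[OF i] inner_minus_left .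
  qed
  assume le: "\<bar>x\<bar> \<le> \<bar>y\<bar>"
  show "norm x \<le> norm y"
  proof (rule norm_le_componentwise)
    fix i :: 'a assume i: "i \<in> Basis"
    have "\<bar>x\<bar> \<bullet> i \<le> \<bar>y\<bar> \<bullet> i"
      using eucl_le[THEN iffD1, OF le] i by (rule bspec)
    then show "\<bar>x \<bullet> i\<bar> \<le> \<bar>y \<bullet> i\<bar>"
      unfolding abs_inner[OF i] .
  qed
qed

(* E^m is the set of lists of length m; the values of A on other lists are irrelevant. *)
definition bounded_multilinear_form :: "nat \<Rightarrow> ('a::real_normed_vector list \<Rightarrow> real) \<Rightarrow> bool" where
  "bounded_multilinear_form m A \<longleftrightarrow>
     (\<forall>xs. length xs = m \<longrightarrow> (\<forall>i<m. linear (\<lambda>v. A (xs[i := v])))) \<and>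
     (\<exists>K. \<forall>xs. length xs = m \<longrightarrow> \<bar>A xs\<bar> \<le> K * (\<Prod>i<m. norm (xs ! i)))"

definition symmetric_form :: "nat \<Rightarrow> ('a list \<Rightarrow> real) \<Rightarrow> bool" where
  "symmetric_form m A \<longleftrightarrow>
     (\<forall>xs p. length xs = m \<longrightarrow> p permutes {..<m} \<longrightarrow> A (map (\<lambda>i. xs ! p i) [0..<m]) = A xs)"

definition homogeneous_polynomial :: "nat \<Rightarrow> ('a::real_normed_vector \<Rightarrow> real) \<Rightarrow> bool" where
  "homogeneous_polynomial m P \<longleftrightarrow>
     (\<exists>A. bounded_multilinear_form m A \<and> symmetric_form m A \<and> (\<forall>x. P x = A (replicate m x)))"

definition orthogonally_additive :: "('a::banach_lattice \<Rightarrow> real) \<Rightarrow> bool" where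
  "orthogonally_additive P \<longleftrightarrow> (\<forall>x y. inf \<bar>x\<bar> \<bar>y\<bar> = 0 \<longrightarrow> P (x + y) = P x + P y)"

definition lattice_homomorphism :: "('a::banach_lattice \<Rightarrow> real) \<Rightarrow> bool" where
  "lattice_homomorphism \<phi> \<longleftrightarrow> bounded_linear \<phi> \<and>
     (\<forall>x y. \<phi> (sup x y) = max (\<phi> x) (\<phi> y) \<and> \<phi> (inf x y) = min (\<phi> x) (\<phi> y))"

end

theory Submission
  imports Defs
begin

text \<open>
  The form \<open>a x\<^sup>m + b y\<^sup>m\<close> on the plane is orthogonally additive, because disjoint vectors never
  have non-zero entries in the same coordinate. The \<open>m\<close>-th finite difference of the polynomial
  \<open>s \<mapsto> (x + s y)\<^sup>m\<close>, whose degree is at most \<open>m\<close>, sees only the coefficient \<open>y\<^sup>m\<close> of \<open>s\<^sup>m\<close>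
  (lemma \<open>alternating_binomial_sum_power\<close>):
  \<open>\<Sum>j=0..m. (-1)\<^sup>j (m choose j) (x + j y)\<^sup>m = (-1)\<^sup>m m! y\<^sup>m\<close>.
  Its term for \<open>j = 0\<close> is \<open>x\<^sup>m\<close>; moving that term to the right leaves \<open>m\<close> powers of the functionals
  \<open>x + j y\<close>, \<open>1 \<le> j \<le> m\<close>, with non-zero weights, whose sum is \<open>(-1)\<^sup>m m! y\<^sup>m - x\<^sup>m\<close>.

  These functionals are pairwise independent, as their slopes \<open>j\<close> differ. Up to sign none is
  a lattice homomorphism: a lattice homomorphism kills at least one of two disjoint positive
  vectors (lemma \<open>lattice_homomorphism_disjoint\<close>), but \<open>x + j y\<close> vanishes at neither unit vector.
\<close>

text \<open>
  For \<open>k > 0\<close>, splitting one factor \<open>x + j y\<close> off the power and absorbing \<open>j\<close> into the binomial coefficient by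
  \<open>j (n choose j) = n (n - 1 choose j - 1)\<close> lowers \<open>k\<close> by one. The absorbed part is a sum
  of order \<open>n - 1\<close> with \<open>x\<close> shifted to \<open>x + y\<close>, so \<open>x\<close> and \<open>n\<close> have to vary in the induction.
\<close>

lemma alternating_binomial_sum_power:
  fixes x y :: "'a::{comm_ring_1,semiring_char_0}"
  assumes "k \<le> n"
  shows "(\<Sum>j\<le>n. (-1) ^ j * of_nat (n choose j) * (x + of_nat j * y) ^ k) =
    (if k = n then (-1) ^ n * fact n * y ^ n else 0)"
  using assms
proof (induction k arbitrary: n x)
  case 0
  then show ?case
    using choose_alternating_sum[of n, where ?'a = 'a] by (cases "n = 0") auto
next
  case (Suc k)
  then obtain r where n: "n = Suc r" and kr: "k \<le> r"
    by (cases n) auto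
  let ?c = "\<lambda>n j. (-1) ^ j * of_nat (n choose j) :: 'a"
  have absorb: "(\<Sum>j\<le>n. of_nat j * (?c n j * (x + of_nat j * y) ^ k)) =
      - of_nat n * (\<Sum>j\<le>r. ?c r j * ((x + y) + of_nat j * y) ^ k)"
  proof -
    have "of_nat (Suc j) * of_nat (n choose Suc j) = (of_nat n * of_nat (r choose j) :: 'a)" for j
      unfolding n of_nat_mult[symmetric] Suc_times_binomial ..
    then have "(-1) ^ Suc j * (of_nat (Suc j) * of_nat (n choose Suc j)) * (x + of_nat (Suc j) * y) ^ k =
        (-1) ^ Suc j * (of_nat n * of_nat (r choose j)) * ((x + y) + of_nat j * y) ^ k" for j
      by (simp add: distrib_right add.assoc del: binomial_Suc_Suc)
    then have "of_nat (Suc j) * (?c n (Suc j) * (x + of_nat (Suc j) * y) ^ k) =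
        - of_nat n * (?c r j * ((x + y) + of_nat j * y) ^ k)" for j
      by (simp add: mult_ac del: of_nat_Suc binomial_Suc_Suc)
    then show ?thesis
      unfolding n sum.atMost_Suc_shift by (simp add: n sum_distrib_left)
  qed
  have zero: "(\<Sum>j\<le>n. ?c n j * (x + of_nat j * y) ^ k) = 0"
    using Suc.IH[of n x] Suc.prems by simp
  have "(\<Sum>j\<le>n. ?c n j * (x + of_nat j * y) ^ Suc k) =
      x * (\<Sum>j\<le>n. ?c n j * (x + of_nat j * y) ^ k) +
      y * (\<Sum>j\<le>n. of_nat j * (?c n j * (x + of_nat j * y) ^ k))"
    by (simp add: sum_distrib_left sum.distrib[symmetric] algebra_simps)
  also have "\<dots> = - y * of_nat n * (\<Sum>j\<le>r. ?c r j * ((x + y) + of_nat j * y) ^ k)"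
    unfolding absorb zero by (simp add: mult_ac)
  also have "\<dots> = (if Suc k = n then (-1) ^ n * fact n * y ^ n else 0)"
    unfolding Suc.IH[OF kr] by (simp add: n algebra_simps)
  finally show ?case .
qed

corollary weighted_power_sum_eq:
  fixes x y :: "'a::{comm_ring_1,semiring_char_0}"
  assumes "m > 0"
  shows "(\<Sum>j=1..m. (-1) ^ j * of_nat (m choose j) * (x + of_nat j * y) ^ m) =
    (-1) ^ m * fact m * y ^ m - x ^ m"
proof -
  have "{..m} = insert 0 {1..m}"
    by auto
  then show ?thesis
    using alternating_binomial_sum_power[of m m x y] by (simp add: algebra_simps)
qed

lemma prod_list_update_nth:
  fixes f :: "'a \<Rightarrow> 'b::comm_monoid_mult"
  assumes "i < length xs"
  shows "(\<Prod>k<length xs. f (xs[i := v] ! k)) = f v * (\<Prod>k\<in>{..<length xs} - {i}. f (xs ! k))"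
proof -
  have "(\<Prod>k<length xs. f (xs[i := v] ! k)) =
      f (xs[i := v] ! i) * (\<Prod>k\<in>{..<length xs} - {i}. f (xs[i := v] ! k))"
    using assms by (intro prod.remove) auto
  also have "(\<Prod>k\<in>{..<length xs} - {i}. f (xs[i := v] ! k)) =
      (\<Prod>k\<in>{..<length xs} - {i}. f (xs ! k))"
    by (intro prod.cong) auto
  finally show ?thesis
    using assms by simp
qed

text \<open>The polarization of \<open>\<phi>\<^sup>m\<close> is \<open>(x\<^sub>1, \<dots>, x\<^sub>m) \<mapsto> \<phi> x\<^sub>1 \<cdots> \<phi> x\<^sub>m\<close>.\<close>

lemma homogeneous_polynomial_sum_powers:
  fixes \<phi> :: "'i \<Rightarrow> 'a::real_normed_vector \<Rightarrow> real"
  assumes bl: "\<And>j. j \<in> J \<Longrightarrow> bounded_linear (\<phi> j)"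
  shows "homogeneous_polynomial m (\<lambda>x. \<Sum>j\<in>J. lam j * \<phi> j x ^ m)"
proof -
  define A where "A xs = (\<Sum>j\<in>J. lam j * (\<Prod>k<m. \<phi> j (xs ! k)))" for xs
  have "linear (\<lambda>v. A (xs[i := v]))" if "length xs = m" "i < m" for xs i
  proof -
    have "A (xs[i := v]) = (\<Sum>j\<in>J. lam j * (\<Prod>k\<in>{..<m} - {i}. \<phi> j (xs ! k)) * \<phi> j v)" for v
      unfolding A_def using prod_list_update_nth[of i xs] that
      by (intro sum.cong) (auto simp: algebra_simps)
    then show ?thesis
      using bl by (auto intro!: bounded_linear.linear bounded_linear_sum
          bounded_linear_const_mult)
  qed
  moreover have "\<bar>A xs\<bar> \<le> (\<Sum>j\<in>J. \<bar>lam j\<bar> * onorm (\<phi> j) ^ m) * (\<Prod>k<m. norm (xs ! k))" for xs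
  proof -
    have "\<bar>A xs\<bar> \<le> (\<Sum>j\<in>J. \<bar>lam j * (\<Prod>k<m. \<phi> j (xs ! k))\<bar>)"
      unfolding A_def by (rule sum_abs)
    also have "\<dots> \<le> (\<Sum>j\<in>J. \<bar>lam j\<bar> * (\<Prod>k<m. onorm (\<phi> j) * norm (xs ! k)))"
      unfolding abs_mult abs_prod
      using onorm[OF bl] by (intro sum_mono mult_left_mono prod_mono) auto
    finally show ?thesis
      by (simp add: prod.distrib sum_distrib_right mult.assoc)
  qed
  ultimately have "bounded_multilinear_form m A"
    unfolding bounded_multilinear_form_def by blast
  moreover have "symmetric_form m A"
    unfolding symmetric_form_def
  proof (intro allI impI)
    fix xs p
    assume p: "p permutes {..<m}"
    have "(\<Prod>k<m. \<phi> j (xs ! p k)) = (\<Prod>k<m. \<phi> j (xs ! k))" for j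
      using prod.permute[OF p, of "\<lambda>k. \<phi> j (xs ! k)"] by (simp add: o_def)
    then show "A (map (\<lambda>i. xs ! p i) [0..<m]) = A xs"
      unfolding A_def by simp
  qed
  moreover have "(\<Sum>j\<in>J. lam j * \<phi> j x ^ m) = A (replicate m x)" for x
    by (simp add: A_def)
  ultimately show ?thesis
    unfolding homogeneous_polynomial_def by blast
qed

lemma lattice_homomorphism_disjoint:
  assumes "lattice_homomorphism \<phi>" "inf x y = 0"
  shows "\<phi> x = 0 \<or> \<phi> y = 0"
proof -
  have "min (\<phi> x) (\<phi> y) = \<phi> (inf x y)"
    using assms(1) by (simp add: lattice_homomorphism_def)
  also have "\<phi> (inf x y) = 0"
    using assms linear_simps(3)[of \<phi>] by (simp add: lattice_homomorphism_def)
  finally show ?thesis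
    by (auto simp: min_def split: if_splits)
qed

lemma inf_axis_axis:
  fixes i j :: "'n::finite"
  assumes "i \<noteq> j"
  shows "inf (axis i 1) (axis j 1 :: real ^ 'n) = 0"
  using assms by (auto simp: vec_eq_iff inf_vec_def axis_def inf_real_def)

lemma orthogonally_additive_diagonal:
  fixes c :: "'n::finite \<Rightarrow> real"
  assumes "m > 0"
  shows "orthogonally_additive (\<lambda>x :: real ^ 'n. \<Sum>i\<in>UNIV. c i * (x $ i) ^ m)"
  unfolding orthogonally_additive_def
proof (intro allI impI)
  fix x y :: "real ^ 'n"
  assume disj: "inf \<bar>x\<bar> \<bar>y\<bar> = 0"
  have "c i * ((x + y) $ i) ^ m = c i * (x $ i) ^ m + c i * (y $ i) ^ m" for i
  proof -
    have "min \<bar>x $ i\<bar> \<bar>y $ i\<bar> = 0"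
      using disj by (auto simp: vec_eq_iff inf_vec_def abs_vec_def inf_real_def)
    then have "x $ i = 0 \<or> y $ i = 0"
      by (auto simp: min_def split: if_splits)
    then show ?thesis
      using assms by (auto simp: power_0_left)
  qed
  then show "(\<Sum>i\<in>UNIV. c i * ((x + y) $ i) ^ m) =
      (\<Sum>i\<in>UNIV. c i * (x $ i) ^ m) + (\<Sum>i\<in>UNIV. c i * (y $ i) ^ m)"
    by (simp add: sum.distrib)
qed

theorem mainTheorem2:
  fixes m :: nat
  assumes "m \<ge> 2"
  shows "\<exists>(lam :: nat \<Rightarrow> real) (\<phi> :: nat \<Rightarrow> real ^ 2 \<Rightarrow> real).
    (\<forall>j\<in>{1..m}. lam j \<noteq> 0) \<and>
    (\<forall>j\<in>{1..m}. bounded_linear (\<phi> j)) \<and>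
    (\<forall>i\<in>{1..m}. \<forall>j\<in>{1..m}. i \<noteq> j \<longrightarrow> (\<forall>c::real. \<phi> i \<noteq> (\<lambda>x. c * \<phi> j x))) \<and>
    (\<forall>j\<in>{1..m}. \<not> lattice_homomorphism (\<phi> j) \<and> \<not> lattice_homomorphism (\<lambda>x. - \<phi> j x)) \<and>
    homogeneous_polynomial m (\<lambda>x. \<Sum>j=1..m. lam j * \<phi> j x ^ m) \<and>
    orthogonally_additive (\<lambda>x. \<Sum>j=1..m. lam j * \<phi> j x ^ m)"
proof -
  define lam where "lam j = (-1) ^ j * real (m choose j)" for j
  define \<phi> where "\<phi> j x = x $ 1 + real j * x $ 2" for j and x :: "real ^ 2"
  let ?e1 = "axis 1 1 :: real ^ 2" and ?e2 = "axis 2 1 :: real ^ 2"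
  have \<phi>_axis: "\<phi> j ?e1 = 1" "\<phi> j ?e2 = real j" for j
    by (simp_all add: \<phi>_def axis_def)
  have disjoint: "inf ?e1 ?e2 = 0"
    by (rule inf_axis_axis) simp
  have lam: "lam j \<noteq> 0" if "j \<in> {1..m}" for j
    using that by (simp add: lam_def)
  have bl: "bounded_linear (\<phi> j)" for j
    unfolding \<phi>_def
    by (intro bounded_linear_add bounded_linear_vec_nth bounded_linear_const_mult)
  have indep: "\<phi> i \<noteq> (\<lambda>x. c * \<phi> j x)" if "i \<noteq> j" for i j c
  proof
    assume eq: "\<phi> i = (\<lambda>x. c * \<phi> j x)"
    have "c = 1"
      using fun_cong[OF eq, of ?e1] by (simp add: \<phi>_axis)
    then show False
      using fun_cong[OF eq, of ?e2] that by (simp add: \<phi>_axis)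
  qed
  have no_hom: "\<not> lattice_homomorphism (\<phi> j) \<and> \<not> lattice_homomorphism (\<lambda>x. - \<phi> j x)"
    if "j \<in> {1..m}" for j
    using lattice_homomorphism_disjoint[of "\<phi> j", OF _ disjoint]
      lattice_homomorphism_disjoint[of "\<lambda>x. - \<phi> j x", OF _ disjoint] that
    by (auto simp: \<phi>_axis)
  have hom: "homogeneous_polynomial m (\<lambda>x. \<Sum>j=1..m. lam j * \<phi> j x ^ m)"
    by (rule homogeneous_polynomial_sum_powers) (rule bl)
  have "orthogonally_additive
      (\<lambda>x :: real ^ 2. \<Sum>i\<in>UNIV. (if i = 1 then - 1 else (-1) ^ m * fact m) * (x $ i) ^ m)"
    using assms by (intro orthogonally_additive_diagonal) simp
  moreover have "(\<Sum>j=1..m. lam j * \<phi> j x ^ m) =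
      (\<Sum>i\<in>UNIV. (if i = 1 then - 1 else (-1) ^ m * fact m) * (x $ i) ^ m)" for x
    using weighted_power_sum_eq[of m "x $ 1" "x $ 2"] assms
    by (simp add: lam_def \<phi>_def UNIV_2)
  ultimately have "orthogonally_additive (\<lambda>x. \<Sum>j=1..m. lam j * \<phi> j x ^ m)"
    by simp
  with lam bl indep no_hom hom show ?thesis
    by blast
qed

end
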